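(* For all $x,y\in D_0([0,1],\mathbb R_+)$, $$d_{\mathrm{GH}}(\mathscr T_x,\mathscr T_y)\le 2\,d_{M_1}(x,y).$$
   Context: $D([0,1])$ is the set of càdlàg (right-continuous with left limits) functions $[0,1]\to\mathbb R$, with the convention $x(0-)=x(0)$. $C_0([0,1],\mathbb R_+)$ (resp. $D_0([0,1],\mathbb R_+)$) is the set of continuous (resp. càdlàg) functions $[0,1]\to\mathbb R_+=[0,\infty)$ vanishing at $0$ and $1$. For $f\in C_0([0,1],\mathbb R_+)$ let $d_f(s,t)=f(s)+f(t)-2\inf_{[s\wedge t,s\vee t]}f$, a pseudo-distance on $[0,1]$; $\mathscr T_f$ is the quotient of $[0,1]$ by the relation $d_f(s,t)=0$, with the distance induced by $d_f$, rooted at $\pi_f(0)$, where $\pi_f:[0,1]\to\mathscr T_f$ is the canonical projection. It is a rooted compact metric space. For $x\in D([0,1])$ the completed graph is $\Gamma_x=\{(\lambda x(t-)+(1-\lambda)x(t),t):(t,\lambda)\in[0,1]^2\}\subset\mathbb R\times[0,1]$, ordered by: $(z_1,t_1)\le(z_2,t_2)$ if either $t_1<t_2$, or $t_1=t_2$ and $|z_1-x(t_1-)|\le|z_2-x(t_2-)|$. A parametric representation of $x$ is a non-decreasing (for this order), continuous and onto function $(\chi,\tau):[0,1]\to\Gamma_x$, with spatial component $\chi:[0,1]\to\mathbb R$ and temporal component $\tau:[0,1]\to[0,1]$; $\mathscr P(x)$ is the set of all of them. The $M_1$ distance is $d_{M_1}(x_1,x_2)=\inf\{\|\chi_1-\chi_2\|_\infty\vee\|\tau_1-\tau_2\|_\infty:(\chi_i,\tau_i)\in\mathscr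 P(x_i),\ i=1,2\}$. For $x\in D_0([0,1],\mathbb R_+)$, $\mathscr T_x$ is the isometry class (as a rooted metric space) of $\mathscr T_\chi$, where $\chi$ is the spatial component of any parametric representation of $x$; it does not depend on the choice. The (rooted) Gromov-Hausdorff distance between rooted compact metric spaces $(K_1,d_1,x_1)$ and $(K_2,d_2,x_2)$ is $d_{\mathrm{GH}}=\frac12\inf_{\mathcal C}\mathrm{dis}(\mathcal C)$, the infimum being over correspondences $\mathcal C\subset K_1\times K_2$ (measurable subsets whose projections on $K_1$ and $K_2$ are onto) containing $(x_1,x_2)$, and $\mathrm{dis}(\mathcal C)=\sup\{|d_1(y_1,z_1)-d_2(y_2,z_2)|:(y_1,y_2),(z_1,z_2)\in\mathcal C\}$. *)

theory Defs
  imports "HOL-Analysis.Analysis"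
begin

text \<open>Functions on \<open>[0,1]\<close> are total functions \<open>real \<Rightarrow> real\<close>; no definition below depends on
  their values outside \<open>{0..1}\<close>.\<close>

subsection \<open>Trees coded by continuous functions\<close>

definition coding_pdist :: "(real \<Rightarrow> real) \<Rightarrow> real \<Rightarrow> real \<Rightarrow> real" where
  "coding_pdist f s t = f s + f t - 2 * (INF u\<in>{min s t..max s t}. f u)"

definition coding_rel :: "(real \<Rightarrow> real) \<Rightarrow> (real \<times> real) set" where
  "coding_rel f = {(s, t). s \<in> {0..1} \<and> t \<in> {0..1} \<and> coding_pdist f s t = 0}"

definition coding_proj :: "(real \<Rightarrow> real) \<Rightarrow> real \<Rightarrow> real set" where
  "coding_proj f s = coding_rel f `` {s}"

text \<open>The distance that \<open>coding_pdist f\<close> induces on equivalence classes. The value \<open>0\<close> off the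
  quotient is there only because \<open>Metric_space\<close> asks for nonnegativity and symmetry of the
  distance at all arguments, not just on the carrier.\<close>

definition coding_dist :: "(real \<Rightarrow> real) \<Rightarrow> real set \<Rightarrow> real set \<Rightarrow> real" where
  "coding_dist f A B =
     (if A \<in> {0..1} // coding_rel f \<and> B \<in> {0..1} // coding_rel f
      then the_elem (\<Union>s\<in>A. \<Union>t\<in>B. {coding_pdist f s t}) else 0)"

text \<open>A rooted metric space is a pair of a metric space and its root.\<close>

type_synonym 'a rooted_metric = "'a metric \<times> 'a"

definition coded_tree :: "(real \<Rightarrow> real) \<Rightarrow> real set rooted_metric" where
  "coded_tree f = (metric ({0..1} // coding_rel f, coding_dist f), coding_proj f 0)"

definition C0 :: "(real \<Rightarrow> real) set" where
  "C0 = {f. continuous_on {0..1} f \<and> (\<forall>t\<in>{0..1}. 0 \<le> f t) \<and> f 0 = 0 \<and> f 1 = 0}"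

text \<open>The constructor \<open>metric\<close> is only meaningful on genuine metric spaces, and
  \<open>the_elem\<close> only on singletons; the following facts show that both are used correctly in
  \<open>coded_tree\<close>.\<close>

lemma coding_pdist_commute: "coding_pdist f s t = coding_pdist f t s"
  by (simp add: coding_pdist_def min.commute max.commute)

context
  fixes f :: "real \<Rightarrow> real"
  assumes f: "f \<in> C0"
begin

lemma coding_bdd: "bdd_below (f ` {min s t..max s t})" if "s \<in> {0..1}" "t \<in> {0..1}"
  using that f by (intro bdd_belowI2[where m = 0]) (auto simp: C0_def min_def max_def split: if_splits)

lemma coding_INF_le: "(INF u\<in>{min s t..max s t}. f u) \<le> f v"
  if "s \<in> {0..1}" "t \<in> {0..1}" "v \<in> {min s t..max s t}"
  using that by (intro cINF_lower coding_bdd)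

lemma coding_pdist_nonneg: "0 \<le> coding_pdist f s t" if "s \<in> {0..1}" "t \<in> {0..1}"
  using coding_INF_le[OF that, of s] coding_INF_le[OF that, of t]
  by (simp add: coding_pdist_def)

lemma coding_pdist_self: "coding_pdist f s s = 0"
  by (simp add: coding_pdist_def)

lemma coding_pdist_triangle: "coding_pdist f s u \<le> coding_pdist f s t + coding_pdist f t u"
  if stu: "s \<in> {0..1}" "t \<in> {0..1}" "u \<in> {0..1}"
proof -
  let ?I = "\<lambda>s t. INF u\<in>{min s t..max s t}. f u"
  have "min (?I s t) (?I t u) \<le> ?I s u"
  proof (rule cINF_greatest)
    fix v assume "v \<in> {min s u..max s u}"
    then have "v \<in> {min s t..max s t} \<or> v \<in> {min t u..max t u}"
      by (auto simp: min_def max_def split: if_splits)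
    then show "min (?I s t) (?I t u) \<le> f v"
      using coding_INF_le stu by (meson min.coboundedI1 min.coboundedI2)
  qed simp
  moreover have "?I s t \<le> f t" "?I t u \<le> f t"
    using stu by (auto intro!: coding_INF_le)
  ultimately show ?thesis
    by (simp add: coding_pdist_def min_def split: if_splits)
qed

lemma equiv_coding_rel: "equiv {0..1} (coding_rel f)"
proof (rule equivI)
  show "trans (coding_rel f)"
  proof (rule transI)
    fix s t u assume "(s, t) \<in> coding_rel f" "(t, u) \<in> coding_rel f"
    then show "(s, u) \<in> coding_rel f"
      using coding_pdist_triangle[of s t u] coding_pdist_nonneg[of s u]
      by (simp add: coding_rel_def)
  qed
qed (auto simp: refl_on_def sym_def coding_rel_def coding_pdist_self coding_pdist_commute)

lemma coding_proj_in: "coding_proj f s \<in> {0..1} // coding_rel f" if "s \<in> {0..1}"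
  using that by (simp add: coding_proj_def quotientI)

lemma coding_dist_proj: "coding_dist f (coding_proj f s) (coding_proj f t) = coding_pdist f s t"
  if st: "s \<in> {0..1}" "t \<in> {0..1}"
proof -
  have eq: "coding_pdist f s' t' = coding_pdist f s t"
    if "(s, s') \<in> coding_rel f" "(t, t') \<in> coding_rel f" for s' t'
    using that coding_pdist_triangle[of s t t'] coding_pdist_triangle[of s s' t']
      coding_pdist_triangle[of s' s t'] coding_pdist_triangle[of s t' t]
      coding_pdist_commute[of f s s'] coding_pdist_commute[of f t t']
    by (auto simp: coding_rel_def)
  have "(s, s) \<in> coding_rel f" "(t, t) \<in> coding_rel f"
    using st by (auto simp: coding_rel_def coding_pdist_self)
  with eq have "(\<Union>s\<in>coding_proj f s. \<Union>t\<in>coding_proj f t. {coding_pdist f s t})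
                = {coding_pdist f s t}"
    unfolding coding_proj_def by blast
  then show ?thesis
    using st by (simp add: coding_dist_def coding_proj_in)
qed

lemma Metric_space_coding: "Metric_space ({0..1} // coding_rel f) (coding_dist f)"
proof -
  have ex: "\<exists>s\<in>{0..1}. A = coding_proj f s" if "A \<in> {0..1} // coding_rel f" for A
    using that by (auto simp: quotient_def coding_proj_def)
  have proj_eq: "coding_proj f s = coding_proj f t \<longleftrightarrow> coding_pdist f s t = 0"
    if "s \<in> {0..1}" "t \<in> {0..1}" for s t
    using eq_equiv_class_iff[OF equiv_coding_rel, of s t] that
    by (simp add: coding_proj_def coding_rel_def)
  show ?thesis
  proof
    fix A B C
    show "0 \<le> coding_dist f A B"
    proof (cases "A \<in> {0..1} // coding_rel f \<and> B \<in> {0..1} // coding_rel f")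
      case True
      then show ?thesis
        using ex by (metis coding_dist_proj coding_pdist_nonneg)
    qed (auto simp: coding_dist_def)
    show "coding_dist f A B = coding_dist f B A"
    proof (cases "A \<in> {0..1} // coding_rel f \<and> B \<in> {0..1} // coding_rel f")
      case True
      then show ?thesis
        using ex by (metis coding_dist_proj coding_pdist_commute)
    qed (auto simp: coding_dist_def)
    assume A: "A \<in> {0..1} // coding_rel f" and B: "B \<in> {0..1} // coding_rel f"
    show "coding_dist f A B = 0 \<longleftrightarrow> A = B"
      using ex[OF A] ex[OF B] by (metis coding_dist_proj proj_eq)
    assume C: "C \<in> {0..1} // coding_rel f"
    show "coding_dist f A C \<le> coding_dist f A B + coding_dist f B C"
      using ex[OF A] ex[OF B] ex[OF C] by (auto simp: coding_dist_proj coding_pdist_triangle)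
  qed
qed

end


subsection \<open>Cadlag functions, parametric representations and the M1 distance\<close>

definition cadlag :: "(real \<Rightarrow> real) set" where
  "cadlag = {x. (\<forall>t\<in>{0..<1}. continuous (at_right t) x) \<and>
                (\<forall>t\<in>{0<..1}. \<exists>l. (x \<longlongrightarrow> l) (at_left t))}"

definition D0 :: "(real \<Rightarrow> real) set" where
  "D0 = {x \<in> cadlag. (\<forall>t\<in>{0..1}. 0 \<le> x t) \<and> x 0 = 0 \<and> x 1 = 0}"

definition left_lim :: "(real \<Rightarrow> real) \<Rightarrow> real \<Rightarrow> real" where
  "left_lim x t = (if t = 0 then x 0 else Lim (at_left t) x)"

definition completed_graph :: "(real \<Rightarrow> real) \<Rightarrow> (real \<times> real) set" where
  "completed_graph x =
     {(c * left_lim x t + (1 - c) * x t, t) | t c. t \<in> {0..1} \<and> c \<in> {0..1}}"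

fun graph_le :: "(real \<Rightarrow> real) \<Rightarrow> real \<times> real \<Rightarrow> real \<times> real \<Rightarrow> bool" where
  "graph_le x (z1, t1) (z2, t2) \<longleftrightarrow>
     t1 < t2 \<or> t1 = t2 \<and> \<bar>z1 - left_lim x t1\<bar> \<le> \<bar>z2 - left_lim x t2\<bar>"

text \<open>A parametric representation \<open>(\<chi>, \<tau>)\<close> is a single function \<open>p\<close> into the completed
  graph, with \<open>\<chi> = fst \<circ> p\<close> and \<open>\<tau> = snd \<circ> p\<close>.\<close>

definition param_reps :: "(real \<Rightarrow> real) \<Rightarrow> (real \<Rightarrow> real \<times> real) set" where
  "param_reps x =
     {p. continuous_on {0..1} p \<and> p ` {0..1} = completed_graph x \<and>
         monotone_on {0..1} (\<le>) (graph_le x) p}"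

definition dM1 :: "(real \<Rightarrow> real) \<Rightarrow> (real \<Rightarrow> real) \<Rightarrow> real" where
  "dM1 x y =
     (INF (p, q)\<in>param_reps x \<times> param_reps y.
        max (SUP s\<in>{0..1}. \<bar>fst (p s) - fst (q s)\<bar>) (SUP s\<in>{0..1}. \<bar>snd (p s) - snd (q s)\<bar>))"

text \<open>The spatial component of a parametric representation of \<open>x \<in> D0\<close> does code a tree.\<close>

lemma left_lim_nonneg:
  assumes x: "x \<in> D0" and t: "t \<in> {0..1}"
  shows "0 \<le> left_lim x t"
proof (cases "t = 0")
  case True
  then show ?thesis using x by (simp add: left_lim_def D0_def)
next
  case False
  with t have "t \<in> {0<..1}" by auto
  with x obtain l where l: "(x \<longlongrightarrow> l) (at_left t)"
    unfolding D0_def cadlag_def by blast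
  have "eventually (\<lambda>s. 0 \<le> x s) (at_left t)"
    using eventually_at_left_real[of 0 t] False t x
    by (auto simp: D0_def elim!: eventually_mono)
  then have "0 \<le> l"
    using l by (intro tendsto_lowerbound[of x l "at_left t" 0]) auto
  moreover have "Lim (at_left t) x = l"
    using l by (intro tendsto_Lim) auto
  ultimately show ?thesis using False by (simp add: left_lim_def)
qed

lemma param_reps_spatial_in_C0:
  assumes x: "x \<in> D0" and p: "p \<in> param_reps x"
  shows "fst \<circ> p \<in> C0"
proof -
  have img: "p ` {0..1} = completed_graph x"
    and mono: "\<And>s t. s \<in> {0..1} \<Longrightarrow> t \<in> {0..1} \<Longrightarrow> s \<le> t \<Longrightarrow> graph_le x (p s) (p t)"
    using p by (auto simp: param_reps_def monotone_on_def)
  have x01: "x 0 = 0" "x 1 = 0" using x by (auto simp: D0_def)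
  have gr: "\<exists>c\<in>{0..1}. fst (p s) = c * left_lim x (snd (p s)) + (1 - c) * x (snd (p s))"
    "snd (p s) \<in> {0..1}" if "s \<in> {0..1}" for s
  proof -
    have "p s \<in> completed_graph x" using img that by blast
    then show "\<exists>c\<in>{0..1}. fst (p s) = c * left_lim x (snd (p s)) + (1 - c) * x (snd (p s))"
      "snd (p s) \<in> {0..1}"
      by (force simp: completed_graph_def)+
  qed
  have "(x t, t) \<in> completed_graph x" if "t \<in> {0..1}" for t
    using that by (auto simp: completed_graph_def intro!: exI[where x = 0])
  then have onto: "\<exists>s\<in>{0..1}. p s = (x t, t)" if "t \<in> {0..1}" for t
    using that img by (metis image_iff)
  have 0: "fst (p 0) = 0"
  proof -
    obtain s where s: "s \<in> {0..1}" "p s = (x 0, 0)" using onto[of 0] by auto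
    have "graph_le x (fst (p 0), snd (p 0)) (x 0, 0)"
      using mono[of 0 s] s by simp
    then have "snd (p 0) = 0" using gr(2)[of 0] by (cases "p 0") auto
    then show ?thesis using gr(1)[of 0] x01 by (auto simp: left_lim_def)
  qed
  have 1: "fst (p 1) = 0"
  proof -
    let ?l = "left_lim x 1"
    obtain s where s: "s \<in> {0..1}" "p s = (x 1, 1)" using onto[of 1] by auto
    have le: "graph_le x (x 1, 1) (fst (p 1), snd (p 1))"
      using mono[of s 1] s by simp
    then have snd1: "snd (p 1) = 1" using gr(2)[of 1] by (cases "p 1") auto
    then obtain c where c: "c \<in> {0..1}" "fst (p 1) = c * ?l" using gr(1)[of 1] x01 by auto
    have "0 \<le> ?l" using left_lim_nonneg[OF x, of 1] by simp
    moreover have "\<bar>?l\<bar> \<le> \<bar>c * ?l - ?l\<bar>" using le snd1 c x01 by (cases "p 1") auto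
    moreover have "\<bar>c * ?l - ?l\<bar> = (1 - c) * ?l"
      using c mult_left_le_one_le[OF calculation(1), of c] by (auto simp: abs_if algebra_simps)
    ultimately have "c * ?l \<le> 0" by (simp add: algebra_simps)
    moreover have "0 \<le> c * ?l" using c \<open>0 \<le> ?l\<close> by simp
    ultimately show ?thesis using c by simp
  qed
  have "0 \<le> fst (p s)" if s: "s \<in> {0..1}" for s
    using gr[OF s] left_lim_nonneg[OF x, of "snd (p s)"] x by (auto simp: D0_def)
  moreover have "continuous_on {0..1} (fst \<circ> p)"
    using p by (auto simp: param_reps_def comp_def intro!: continuous_on_fst)
  ultimately show ?thesis using 0 1 by (simp add: C0_def)
qed


subsection \<open>Rooted isometry classes and the Gromov-Hausdorff distance\<close>

definition rooted_isometric :: "'a rooted_metric \<Rightarrow> 'b rooted_metric \<Rightarrow> bool" where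
  "rooted_isometric X Y \<longleftrightarrow>
     snd X \<in> mspace (fst X) \<and> snd Y \<in> mspace (fst Y) \<and>
     (\<exists>\<phi>. bij_betw \<phi> (mspace (fst X)) (mspace (fst Y)) \<and> \<phi> (snd X) = snd Y \<and>
          (\<forall>a\<in>mspace (fst X). \<forall>b\<in>mspace (fst X). mdist (fst Y) (\<phi> a) (\<phi> b) = mdist (fst X) a b))"

text \<open>The isometry class of the tree coded by the spatial component of any parametric
  representation of \<open>x\<close>. The carrier type \<open>'a\<close> of its members is arbitrary.\<close>

definition tree_class :: "(real \<Rightarrow> real) \<Rightarrow> 'a rooted_metric set" where
  "tree_class x = {X. \<exists>p\<in>param_reps x. rooted_isometric X (coded_tree (fst \<circ> p))}"

lemma coded_tree_in_tree_class:
  assumes "x \<in> D0" "p \<in> param_reps x"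
  shows "coded_tree (fst \<circ> p) \<in> tree_class x"
proof -
  have f: "fst \<circ> p \<in> C0" using param_reps_spatial_in_C0 assms .
  have "rooted_isometric (coded_tree (fst \<circ> p)) (coded_tree (fst \<circ> p))"
    using coding_proj_in[OF f, of 0] Metric_space.mspace_metric[OF Metric_space_coding[OF f]]
    by (auto simp: rooted_isometric_def coded_tree_def intro!: exI[where x = id])
  then show ?thesis using assms(2) by (auto simp: tree_class_def)
qed

text \<open>Correspondences are measurable for the Borel sets of the product topology.\<close>

definition rooted_correspondences ::
  "'a rooted_metric \<Rightarrow> 'b rooted_metric \<Rightarrow> ('a \<times> 'b) set set" where
  "rooted_correspondences X Y =
     {C. C \<in> sigma_sets (mspace (fst X) \<times> mspace (fst Y))
               {U. openin (prod_topology (mtopology_of (fst X)) (mtopology_of (fst Y))) U} \<and>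
         fst ` C = mspace (fst X) \<and> snd ` C = mspace (fst Y) \<and> (snd X, snd Y) \<in> C}"

definition distortion :: "'a metric \<Rightarrow> 'b metric \<Rightarrow> ('a \<times> 'b) set \<Rightarrow> real" where
  "distortion m1 m2 C =
     (SUP ((y1, y2), (z1, z2))\<in>C \<times> C. \<bar>mdist m1 y1 z1 - mdist m2 y2 z2\<bar>)"

definition dGH :: "'a rooted_metric \<Rightarrow> 'b rooted_metric \<Rightarrow> real" where
  "dGH X Y = 1/2 * (INF C\<in>rooted_correspondences X Y. distortion (fst X) (fst Y) C)"

end

theory Submission
  imports Defs
begin

text \<open>A rooted space \<open>X\<close> isometric to the tree coded by \<open>f\<close> is parametrized by \<open>[0,1]\<close>: there is
  a map \<open>h\<close> from \<open>[0,1]\<close> onto \<open>X\<close>, sending \<open>0\<close> to the root, along which the distance of \<open>X\<close> is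
  \<open>coding_pdist f\<close> (\<open>tree_coding\<close>). If \<open>h\<close> and \<open>k\<close> are such maps for \<open>(f, X)\<close> and
  \<open>(g, Y)\<close>, then the pairs \<open>(h s, k s)\<close> form a rooted correspondence. It is measurable because
  it is closed, being a continuous image of the compact interval in a Hausdorff space. An infimum
  is 1-Lipschitz in the function for the uniform distance, so \<open>coding_pdist f\<close> and
  \<open>coding_pdist g\<close> differ by at most four times the uniform distance of \<open>f\<close> and \<open>g\<close>; this
  bounds the distortion, and halving it gives the factor \<open>2\<close> (\<open>dGH_le_of_tree_codings\<close>).

  The \<open>M1\<close> distance is an infimum over all pairs of parametric representations, while the
  members of \<open>tree_class x\<close> come with one particular representation. The gap is closed by
  independence of the representation: a representation \<open>p\<close> is monotone and onto, and the order of
  the completed graph is antisymmetric, so \<open>p\<close> maps the interval between \<open>s\<close> and \<open>t\<close> exactly onto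
  the order interval between \<open>p s\<close> and \<open>p t\<close>. Hence \<open>coding_pdist (fst \<circ> p) s t\<close> is a function
  of the two points \<open>p s\<close> and \<open>p t\<close> of the graph alone, and any space parametrized through one
  representation is parametrized through every other one (\<open>tree_coding_change_param\<close>).\<close>


section \<open>The coding pseudo-distance\<close>

lemma coding_pdist_continuous:
  assumes f: "f \<in> C0" and s: "s \<in> {0..1}" and e: "0 < e"
  shows "\<exists>d>0. \<forall>t\<in>{0..1}. \<bar>t - s\<bar> < d \<longrightarrow> coding_pdist f s t < e"
proof -
  have "continuous_on {0..1} f" using f by (simp add: C0_def)
  then obtain d where d: "d > 0" "\<And>u. u \<in> {0..1} \<Longrightarrow> dist u s < d \<Longrightarrow> dist (f u) (f s) < e/4"
    using s e unfolding continuous_on_iff by (metis zero_less_divide_iff zero_less_numeral)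
  have "coding_pdist f s t < e" if t: "t \<in> {0..1}" "\<bar>t - s\<bar> < d" for t
  proof -
    have near: "\<bar>f u - f s\<bar> < e/4" if "u \<in> {min s t..max s t}" for u
    proof -
      have "u \<in> {0..1}" "dist u s < d"
        using that t s by (auto simp: dist_real_def min_def max_def split: if_splits)
      then show ?thesis using d(2) by (simp add: dist_real_def)
    qed
    have "f s - e/4 \<le> (INF u\<in>{min s t..max s t}. f u)"
    proof (rule cINF_greatest)
      show "f s - e/4 \<le> f u" if "u \<in> {min s t..max s t}" for u
        using near[OF that] by linarith
    qed simp
    moreover have "\<bar>f t - f s\<bar> < e/4" by (rule near) auto
    ultimately show ?thesis using e unfolding coding_pdist_def by linarith
  qed
  then show ?thesis using d(1) by blast
qed

lemma coding_pdist_bounded: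
  assumes f: "f \<in> C0"
  shows "\<exists>M. \<forall>s\<in>{0..1}. \<forall>t\<in>{0..1}. coding_pdist f s t \<le> M"
proof -
  have "compact (f ` {0..1})"
    using f by (intro compact_continuous_image) (auto simp: C0_def)
  then have "bdd_above (f ` {0..1})" by (simp add: bounded_imp_bdd_above compact_imp_bounded)
  then obtain B where B: "\<And>u. u \<in> {0..1} \<Longrightarrow> f u \<le> B"
    unfolding bdd_above_def by blast
  have "coding_pdist f s t \<le> B + B" if st: "s \<in> {0..1}" "t \<in> {0..1}" for s t
  proof -
    have "0 \<le> (INF u\<in>{min s t..max s t}. f u)"
      using st f by (intro cINF_greatest) (auto simp: C0_def min_def max_def split: if_splits)
    then show ?thesis using B[OF st(1)] B[OF st(2)] by (simp add: coding_pdist_def)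
  qed
  then show ?thesis by blast
qed

lemma INF_diff_le:
  fixes f g :: "'c \<Rightarrow> real"
  assumes "A \<noteq> {}" "bdd_below (f ` A)" "\<And>u. u \<in> A \<Longrightarrow> \<bar>f u - g u\<bar> \<le> D"
  shows "(INF u\<in>A. f u) \<le> (INF u\<in>A. g u) + D"
proof -
  have "(INF u\<in>A. f u) - D \<le> (INF u\<in>A. g u)"
  proof (rule cINF_greatest[OF assms(1)])
    fix u assume u: "u \<in> A"
    show "(INF u\<in>A. f u) - D \<le> g u"
      using cINF_lower[OF assms(2) u] assms(3)[OF u] by linarith
  qed
  then show ?thesis by simp
qed

text \<open>Each of the two endpoint values contributes \<open>D\<close>, and the doubled infimum \<open>2 * D\<close>.\<close>

lemma coding_pdist_lipschitz:
  assumes f: "f \<in> C0" and g: "g \<in> C0"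
    and D: "\<And>u. u \<in> {0..1} \<Longrightarrow> \<bar>f u - g u\<bar> \<le> D"
    and st: "s \<in> {0..1}" "t \<in> {0..1}"
  shows "\<bar>coding_pdist f s t - coding_pdist g s t\<bar> \<le> 4 * D"
proof -
  let ?A = "{min s t..max s t}"
  have A: "u \<in> {0..1}" if "u \<in> ?A" for u
    using that st by (auto simp: min_def max_def split: if_splits)
  have "(INF u\<in>?A. f u) \<le> (INF u\<in>?A. g u) + D"
    by (rule INF_diff_le) (use coding_bdd[OF f st] D A in auto)
  moreover have "(INF u\<in>?A. g u) \<le> (INF u\<in>?A. f u) + D"
    by (rule INF_diff_le) (use coding_bdd[OF g st] D A in \<open>auto simp: abs_minus_commute\<close>)
  ultimately show ?thesis
    using D[OF st(1)] D[OF st(2)] unfolding coding_pdist_def by linarith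
qed


section \<open>Spaces parametrized by a coding function\<close>

definition tree_coding :: "(real \<Rightarrow> real) \<Rightarrow> 'a rooted_metric \<Rightarrow> (real \<Rightarrow> 'a) \<Rightarrow> bool" where
  "tree_coding f X h \<longleftrightarrow>
     h ` {0..1} = mspace (fst X) \<and> h 0 = snd X \<and>
     (\<forall>s\<in>{0..1}. \<forall>t\<in>{0..1}. mdist (fst X) (h s) (h t) = coding_pdist f s t)"

lemma rooted_isometric_imp_tree_coding:
  assumes f: "f \<in> C0" and iso: "rooted_isometric X (coded_tree f)"
  shows "\<exists>h. tree_coding f X h"
proof -
  let ?Q = "{0..1} // coding_rel f"
  interpret Q: Metric_space ?Q "coding_dist f" using Metric_space_coding[OF f] .
  obtain \<phi> where bij: "bij_betw \<phi> (mspace (fst X)) ?Q"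
    and root: "snd X \<in> mspace (fst X)" "\<phi> (snd X) = coding_proj f 0"
    and dist: "\<And>a b. a \<in> mspace (fst X) \<Longrightarrow> b \<in> mspace (fst X) \<Longrightarrow>
                coding_dist f (\<phi> a) (\<phi> b) = mdist (fst X) a b"
    using iso by (auto simp: rooted_isometric_def coded_tree_def)
  define h where "h = the_inv_into (mspace (fst X)) \<phi> \<circ> coding_proj f"
  have inj: "inj_on \<phi> (mspace (fst X))" and im: "\<phi> ` mspace (fst X) = ?Q"
    using bij by (auto simp: bij_betw_def)
  have proj: "coding_proj f ` {0..1} = ?Q"
    by (auto simp: quotient_def coding_proj_def)
  have h_in: "h s \<in> mspace (fst X)" and \<phi>h: "\<phi> (h s) = coding_proj f s" if "s \<in> {0..1}" for s
    using coding_proj_in[OF f that] inj im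
    by (auto simp: h_def intro!: the_inv_into_into f_the_inv_into_f)
  have "h ` {0..1} = mspace (fst X)"
    unfolding h_def image_comp[symmetric] proj
    using the_inv_into_onto[OF inj] im by simp
  moreover have "h 0 = snd X"
    using the_inv_into_f_f[OF inj root(1)] root(2) by (simp add: h_def)
  moreover have "mdist (fst X) (h s) (h t) = coding_pdist f s t"
    if "s \<in> {0..1}" "t \<in> {0..1}" for s t
    using dist[OF h_in[OF that(1)] h_in[OF that(2)]] that
    by (simp add: \<phi>h coding_dist_proj[OF f])
  ultimately show ?thesis unfolding tree_coding_def by blast
qed

lemma tree_coding_continuous:
  assumes f: "f \<in> C0" and h: "tree_coding f X h"
  shows "continuous_map (top_of_set {0..1}) (mtopology_of (fst X)) h"
proof -
  interpret M: Metric_space "mspace (fst X)" "mdist (fst X)" by simp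
  have h_in: "h s \<in> mspace (fst X)" if "s \<in> {0..1}" for s
    using h that by (auto simp: tree_coding_def)
  have hd: "mdist (fst X) (h s) (h t) = coding_pdist f s t" if "s \<in> {0..1}" "t \<in> {0..1}" for s t
    using h that by (auto simp: tree_coding_def)
  have "continuous_map (top_of_set {0..1}) M.mtopology h"
    unfolding M.continuous_map_to_metric
  proof (intro ballI allI impI)
    fix s e :: real assume "s \<in> topspace (top_of_set {0..1})" and e: "0 < e"
    then have s: "s \<in> {0..1}" by simp
    obtain d where d: "d > 0" "\<And>t. t \<in> {0..1} \<Longrightarrow> \<bar>t - s\<bar> < d \<Longrightarrow> coding_pdist f s t < e"
      using coding_pdist_continuous[OF f s e] by blast
    have "openin (top_of_set {0..1}) ({0..1} \<inter> ball s d)" by (simp add: openin_open_Int)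
    moreover have "s \<in> {0..1} \<inter> ball s d" using s d(1) by simp
    moreover have "\<forall>t\<in>{0..1} \<inter> ball s d. h t \<in> M.mball (h s) e"
      using s d(2) h_in hd by (auto simp: dist_real_def abs_minus_commute)
    ultimately show "\<exists>U. openin (top_of_set {0..1}) U \<and> s \<in> U \<and> (\<forall>t\<in>U. h t \<in> M.mball (h s) e)"
      by blast
  qed
  then show ?thesis by (simp add: mtopology_of_def)
qed


section \<open>The Gromov-Hausdorff distance of two parametrized spaces\<close>

text \<open>Pairing points with the same parameter gives a compact subset of a Hausdorff space; being
  closed, it is Borel.\<close>

lemma tree_codings_correspondence:
  assumes f: "f \<in> C0" and g: "g \<in> C0" and h: "tree_coding f X h" and k: "tree_coding g Y k"
  shows "(\<lambda>s. (h s, k s)) ` {0..1} \<in> rooted_correspondences X Y"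
proof -
  let ?C = "(\<lambda>s. (h s, k s)) ` {0..1}"
  let ?\<Omega> = "mspace (fst X) \<times> mspace (fst Y)"
  let ?T = "prod_topology (mtopology_of (fst X)) (mtopology_of (fst Y))"
  have "continuous_map (top_of_set {0..1}) ?T (\<lambda>s. (h s, k s))"
    using tree_coding_continuous[OF f h] tree_coding_continuous[OF g k]
    by (simp add: continuous_map_pairedI)
  moreover have "compactin (top_of_set {0..1}) {0..1::real}"
    by (simp add: compactin_subtopology)
  ultimately have "compactin ?T ?C" by (rule image_compactin[rotated])
  moreover have "Hausdorff_space ?T"
    by (simp add: Hausdorff_space_prod_topology Metric_space.Hausdorff_space_mtopology
        mtopology_of_def)
  ultimately have "closedin ?T ?C" by (simp add: compactin_imp_closedin)
  then have op: "openin ?T (?\<Omega> - ?C)" and sub: "?C \<subseteq> ?\<Omega>"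
    by (auto simp: closedin_def topspace_mtopology_of)
  have "?\<Omega> - (?\<Omega> - ?C) \<in> sigma_sets ?\<Omega> {U. openin ?T U}"
    using op by (intro sigma_sets.Compl sigma_sets.Basic) simp
  moreover have "?\<Omega> - (?\<Omega> - ?C) = ?C" using sub by blast
  ultimately have "?C \<in> sigma_sets ?\<Omega> {U. openin ?T U}" by simp
  moreover have "fst ` ?C = mspace (fst X)" "snd ` ?C = mspace (fst Y)"
    using h k by (simp_all add: tree_coding_def image_image)
  moreover have "(snd X, snd Y) \<in> ?C"
    using h k by (auto simp: tree_coding_def intro: image_eqI[where x = 0])
  ultimately show ?thesis by (simp add: rooted_correspondences_def)
qed

text \<open>The supremum in the definition of \<open>distortion\<close> is only meaningful over a bounded set;
  boundedness of the two spaces provides this, and the pair of roots contributes the value \<open>0\<close>.\<close>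

lemma distortion_nonneg:
  assumes f: "f \<in> C0" and g: "g \<in> C0" and h: "tree_coding f X h" and k: "tree_coding g Y k"
    and C: "C \<in> rooted_correspondences X Y"
  shows "0 \<le> distortion (fst X) (fst Y) C"
proof -
  obtain M where M: "\<forall>s\<in>{0..1}. \<forall>t\<in>{0..1}. coding_pdist f s t \<le> M"
    using coding_pdist_bounded[OF f] ..
  obtain N where N: "\<forall>s\<in>{0..1}. \<forall>t\<in>{0..1}. coding_pdist g s t \<le> N"
    using coding_pdist_bounded[OF g] ..
  have X: "mdist (fst X) a b \<le> M" if "a \<in> mspace (fst X)" "b \<in> mspace (fst X)" for a b
  proof -
    have "a \<in> h ` {0..1}" "b \<in> h ` {0..1}" using that h by (simp_all add: tree_coding_def)
    then obtain s t where "s \<in> {0..1}" "t \<in> {0..1}" "a = h s" "b = h t" by blast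
    then show ?thesis using h M by (simp add: tree_coding_def)
  qed
  have Y: "mdist (fst Y) a b \<le> N" if "a \<in> mspace (fst Y)" "b \<in> mspace (fst Y)" for a b
  proof -
    have "a \<in> k ` {0..1}" "b \<in> k ` {0..1}" using that k by (simp_all add: tree_coding_def)
    then obtain s t where "s \<in> {0..1}" "t \<in> {0..1}" "a = k s" "b = k t" by blast
    then show ?thesis using k N by (simp add: tree_coding_def)
  qed
  have C': "fst ` C = mspace (fst X)" "snd ` C = mspace (fst Y)" and root: "(snd X, snd Y) \<in> C"
    using C by (auto simp: rooted_correspondences_def)
  have mem: "a \<in> mspace (fst X)" "b \<in> mspace (fst Y)" if "(a, b) \<in> C" for a b
    using that C' by force+
  let ?F = "\<lambda>((y1, y2), (z1, z2)). \<bar>mdist (fst X) y1 z1 - mdist (fst Y) y2 z2\<bar>"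
  have "bdd_above (?F ` (C \<times> C))"
  proof (rule bdd_aboveI2)
    fix w assume "w \<in> C \<times> C"
    then obtain y1 y2 z1 z2 where w: "w = ((y1, y2), (z1, z2))" "(y1, y2) \<in> C" "(z1, z2) \<in> C"
      by auto
    show "?F w \<le> M + N"
      using X[OF mem(1)[OF w(2)] mem(1)[OF w(3)]] Y[OF mem(2)[OF w(2)] mem(2)[OF w(3)]]
        mdist_nonneg[of "fst X" y1 z1] mdist_nonneg[of "fst Y" y2 z2]
      unfolding w(1) prod.case by linarith
  qed
  moreover have "((snd X, snd Y), (snd X, snd Y)) \<in> C \<times> C" using root by simp
  ultimately have "?F ((snd X, snd Y), (snd X, snd Y)) \<le> distortion (fst X) (fst Y) C"
    unfolding distortion_def by (intro cSUP_upper)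
  then show ?thesis by (smt (verit) prod.case)
qed

lemma dGH_le_of_tree_codings:
  assumes f: "f \<in> C0" and g: "g \<in> C0" and h: "tree_coding f X h" and k: "tree_coding g Y k"
    and D: "\<And>u. u \<in> {0..1} \<Longrightarrow> \<bar>f u - g u\<bar> \<le> D"
  shows "dGH X Y \<le> 2 * D"
proof -
  let ?C = "(\<lambda>s. (h s, k s)) ` {0..1}"
  have C: "?C \<in> rooted_correspondences X Y"
    using tree_codings_correspondence[OF f g h k] .
  have "distortion (fst X) (fst Y) ?C \<le> 4 * D"
    unfolding distortion_def
  proof (rule cSUP_least)
    show "?C \<times> ?C \<noteq> {}" by auto
    fix w assume "w \<in> ?C \<times> ?C"
    then obtain s t where "s \<in> {0..1}" "t \<in> {0..1}" "w = ((h s, k s), (h t, k t))" by auto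
    then show "(case w of (x, xa) \<Rightarrow> (case x of (y1, y2) \<Rightarrow> \<lambda>(z1, z2).
        \<bar>mdist (fst X) y1 z1 - mdist (fst Y) y2 z2\<bar>) xa) \<le> 4 * D"
      using coding_pdist_lipschitz[OF f g D] h k by (simp add: tree_coding_def)
  qed
  moreover have "(INF C\<in>rooted_correspondences X Y. distortion (fst X) (fst Y) C)
      \<le> distortion (fst X) (fst Y) ?C"
    using C distortion_nonneg[OF f g h k] by (intro cINF_lower bdd_belowI2[where m = 0]) auto
  ultimately show ?thesis by (simp add: dGH_def)
qed


section \<open>Independence of the parametric representation\<close>

lemma graph_le_antisym:
  assumes "a \<in> completed_graph x" "b \<in> completed_graph x" "graph_le x a b" "graph_le x b a"
  shows "a = b"
proof -
  obtain c t where c: "a = (c * left_lim x t + (1 - c) * x t, t)" "c \<in> {0..1}"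
    using assms(1) by (auto simp: completed_graph_def)
  obtain d u where d: "b = (d * left_lim x u + (1 - d) * x u, u)" "d \<in> {0..1}"
    using assms(2) by (auto simp: completed_graph_def)
  have [simp]: "u = t" using assms(3,4) c d by auto
  \<comment> \<open>On the segment over \<open>t\<close> the distance to the left limit determines the point.\<close>
  have gap: "\<bar>e * left_lim x t + (1 - e) * x t - left_lim x t\<bar>
      = (1 - e) * \<bar>x t - left_lim x t\<bar>" if "e \<in> {0..1}" for e
  proof -
    have "e * left_lim x t + (1 - e) * x t - left_lim x t = (1 - e) * (x t - left_lim x t)"
      by (simp add: algebra_simps)
    then show ?thesis using that by (simp add: abs_mult)
  qed
  have "(1 - c) * \<bar>x t - left_lim x t\<bar> = (1 - d) * \<bar>x t - left_lim x t\<bar>"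
    using assms(3,4) gap[OF c(2)] gap[OF d(2)] c d by auto
  then have "c = d \<or> x t = left_lim x t" by auto
  then show ?thesis using c d by (auto simp: algebra_simps)
qed

text \<open>Symmetric in the endpoints, to match the interval \<open>{min s t..max s t}\<close> in
  \<open>coding_pdist\<close>.\<close>

definition graph_between :: "(real \<Rightarrow> real) \<Rightarrow> real \<times> real \<Rightarrow> real \<times> real \<Rightarrow> (real \<times> real) set" where
  "graph_between x a b = {z \<in> completed_graph x.
     graph_le x a z \<and> graph_le x z b \<or> graph_le x b z \<and> graph_le x z a}"

text \<open>Surjectivity supplies a parameter \<open>u\<close> for each graph point in between. If \<open>u\<close> falls outside
  the interval of parameters, monotonicity and antisymmetry force the point to be an endpoint,
  so it is attained inside the interval after all.\<close>

lemma param_rep_image_between: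
  assumes p: "p \<in> param_reps x" and st: "s \<in> {0..1}" "t \<in> {0..1}"
  shows "p ` {min s t..max s t} = graph_between x (p s) (p t)"
proof -
  have img: "p ` {0..1} = completed_graph x"
    and mono: "\<And>s t. s \<in> {0..1} \<Longrightarrow> t \<in> {0..1} \<Longrightarrow> s \<le> t \<Longrightarrow> graph_le x (p s) (p t)"
    using p by (auto simp: param_reps_def monotone_on_def)
  have anti: "p u = p v" if "u \<in> {0..1}" "v \<in> {0..1}" "graph_le x (p u) (p v)" "u \<ge> v" for u v
    using that img mono[of v u] by (intro graph_le_antisym[of _ x]) auto
  have *: "p ` {s..t} = graph_between x (p s) (p t)" if st: "s \<in> {0..1}" "t \<in> {0..1}" "s \<le> t" for s t
  proof
    show "p ` {s..t} \<subseteq> graph_between x (p s) (p t)"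
      using st mono img by (auto simp: graph_between_def)
    show "graph_between x (p s) (p t) \<subseteq> p ` {s..t}"
    proof
      fix z assume z: "z \<in> graph_between x (p s) (p t)"
      then obtain u where u: "u \<in> {0..1}" "z = p u"
        using img unfolding graph_between_def by blast
      \<comment> \<open>If \<open>z\<close> lies between \<open>p t\<close> and \<open>p s\<close> in the reversed order, then all three coincide.\<close>
      have le: "graph_le x (p s) (p u)" "graph_le x (p u) (p t)"
      proof -
        consider "graph_le x (p s) (p u)" "graph_le x (p u) (p t)"
          | "graph_le x (p t) (p u)" "graph_le x (p u) (p s)"
          using z u by (auto simp: graph_between_def)
        then have "graph_le x (p s) (p u) \<and> graph_le x (p u) (p t)"
        proof cases
          case 2
          show ?thesis
          proof (cases "u \<le> s")
            case True
            then have "p t = p u" using anti[of t u] 2(1) u(1) st by simp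
            then show ?thesis using mono[of s t] mono[of t t] st by simp
          next
            case False
            then have "p u = p s" using anti[of u s] 2(2) u(1) st by simp
            then show ?thesis using mono[of s t] mono[of s s] st by simp
          qed
        qed auto
        then show "graph_le x (p s) (p u)" "graph_le x (p u) (p t)" by auto
      qed
      consider "u < s" | "u \<in> {s..t}" | "t < u" by fastforce
      then show "z \<in> p ` {s..t}"
      proof cases
        case 1
        then have "z = p s" using anti[of s u] le(1) u st by simp
        then show ?thesis using st by simp
      next
        case 3
        then have "z = p t" using anti[of u t] le(2) u st by simp
        then show ?thesis using st by simp
      qed (use u in auto)
    qed
  qed
  have sym: "graph_between x a b = graph_between x b a" for a b
    by (auto simp: graph_between_def)
  show ?thesis
    using *[OF st] *[OF st(2,1)] sym by (cases "s \<le> t") (auto simp: min_def max_def)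
qed

lemma param_rep_coding_pdist:
  assumes p: "p \<in> param_reps x" and st: "s \<in> {0..1}" "t \<in> {0..1}"
  shows "coding_pdist (fst \<circ> p) s t =
    fst (p s) + fst (p t) - 2 * (INF z\<in>graph_between x (p s) (p t). fst z)"
  unfolding coding_pdist_def param_rep_image_between[OF assms, symmetric] by (simp add: image_image)

text \<open>Precompose \<open>h\<close> with any map, possibly discontinuous, that takes a parameter of \<open>p'\<close> to a
  parameter of \<open>p\<close> over the same graph point: distances are determined by graph points.
  Root and surjectivity are preserved because \<open>h\<close> is constant on the fibres of \<open>p\<close>.\<close>

lemma tree_coding_change_param:
  assumes p: "p \<in> param_reps x" and p': "p' \<in> param_reps x"
    and h: "tree_coding (fst \<circ> p) X h"
  shows "\<exists>h'. tree_coding (fst \<circ> p') X h'"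
proof -
  have img: "p ` {0..1} = completed_graph x" "p' ` {0..1} = completed_graph x"
    using p p' by (auto simp: param_reps_def)
  have "\<exists>r. \<forall>s\<in>{0..1}. r s \<in> {0..1} \<and> p (r s) = p' s"
    using img by (intro bchoice) (metis imageE imageI)
  then obtain r where r: "\<And>s. s \<in> {0..1} \<Longrightarrow> r s \<in> {0..1}" "\<And>s. s \<in> {0..1} \<Longrightarrow> p (r s) = p' s"
    by blast
  have h_img: "h ` {0..1} = mspace (fst X)" and h0: "h 0 = snd X"
    and hd: "\<And>s t. s \<in> {0..1} \<Longrightarrow> t \<in> {0..1} \<Longrightarrow>
               mdist (fst X) (h s) (h t) = coding_pdist (fst \<circ> p) s t"
    using h by (auto simp: tree_coding_def)
  have h_eq: "h u = h v" if "u \<in> {0..1}" "v \<in> {0..1}" "p u = p v" for u v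
  proof -
    have "coding_pdist (fst \<circ> p) u v = coding_pdist (fst \<circ> p) u u"
      using that by (simp add: param_rep_coding_pdist[OF p])
    then have "mdist (fst X) (h u) (h v) = 0"
      using that by (simp add: hd coding_pdist_def)
    moreover have "h u \<in> mspace (fst X)" "h v \<in> mspace (fst X)" using h_img that by auto
    ultimately show ?thesis by simp
  qed
  have least: "graph_le x (q 0) z" if "q \<in> param_reps x" "z \<in> completed_graph x" for q z
  proof -
    have "z \<in> q ` {0..1}" using that by (simp add: param_reps_def)
    then obtain u where "u \<in> {0..1}" "z = q u" by blast
    then show ?thesis using that(1) by (simp add: param_reps_def monotone_on_def)
  qed
  have "p 0 = p' 0"
  proof (rule graph_le_antisym)
    show in_graph: "p 0 \<in> completed_graph x" "p' 0 \<in> completed_graph x" using img by auto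
    show "graph_le x (p 0) (p' 0)" "graph_le x (p' 0) (p 0)"
      using least p p' in_graph by blast+
  qed
  then have "(h \<circ> r) 0 = snd X" using h_eq[of "r 0" 0] r h0 by simp
  moreover have "(h \<circ> r) ` {0..1} = mspace (fst X)"
  proof
    show "(h \<circ> r) ` {0..1} \<subseteq> mspace (fst X)" using r h_img by auto
    show "mspace (fst X) \<subseteq> (h \<circ> r) ` {0..1}"
    proof
      fix a assume "a \<in> mspace (fst X)"
      then obtain u where u: "u \<in> {0..1}" "a = h u" using h_img by blast
      then obtain s where s: "s \<in> {0..1}" "p' s = p u" using img by (metis imageE imageI)
      then have "h (r s) = a" using h_eq[of "r s" u] r u by simp
      then show "a \<in> (h \<circ> r) ` {0..1}" using s by auto
    qed
  qed
  moreover have "mdist (fst X) ((h \<circ> r) s) ((h \<circ> r) t) = coding_pdist (fst \<circ> p') s t"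
    if "s \<in> {0..1}" "t \<in> {0..1}" for s t
    using that r by (simp add: hd param_rep_coding_pdist[OF p] param_rep_coding_pdist[OF p'])
  ultimately show ?thesis unfolding tree_coding_def by blast
qed

lemma tree_class_imp_tree_coding:
  assumes x: "x \<in> D0" and X: "X \<in> tree_class x" and p: "p \<in> param_reps x"
  shows "\<exists>h. tree_coding (fst \<circ> p) X h"
proof -
  obtain p0 where p0: "p0 \<in> param_reps x" "rooted_isometric X (coded_tree (fst \<circ> p0))"
    using X by (auto simp: tree_class_def)
  show ?thesis
    using rooted_isometric_imp_tree_coding[OF param_reps_spatial_in_C0[OF x p0(1)] p0(2)]
      tree_coding_change_param[OF p0(1) p] by blast
qed


section \<open>Comparison with the \<open>M1\<close> distance\<close>

theorem proposition1p1:
  fixes x y :: "real \<Rightarrow> real"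
    and X :: "'a rooted_metric" and Y :: "'b rooted_metric"
  assumes "x \<in> D0" and "y \<in> D0"
    and "X \<in> tree_class x" and "Y \<in> tree_class y"
  shows "dGH X Y \<le> 2 * dM1 x y"
proof -
  have "dGH X Y / 2 \<le> dM1 x y"
    unfolding dM1_def
  proof (rule cINF_greatest)
    \<comment> \<open>Parametric representations exist because \<open>X\<close> and \<open>Y\<close> come from some.\<close>
    show "param_reps x \<times> param_reps y \<noteq> {}"
      using assms(3,4) by (auto simp: tree_class_def)
    fix w assume "w \<in> param_reps x \<times> param_reps y"
    then obtain p q where w: "w = (p, q)" and p: "p \<in> param_reps x" and q: "q \<in> param_reps y"
      by auto
    obtain h k where h: "tree_coding (fst \<circ> p) X h" and k: "tree_coding (fst \<circ> q) Y k"
      using tree_class_imp_tree_coding[OF assms(1,3) p] tree_class_imp_tree_coding[OF assms(2,4) q]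
      by blast
    have f: "fst \<circ> p \<in> C0" and g: "fst \<circ> q \<in> C0"
      using param_reps_spatial_in_C0 assms(1,2) p q by blast+
    let ?d = "\<lambda>s. \<bar>fst (p s) - fst (q s)\<bar>"
    have "continuous_on {0..1} ?d"
      using f g by (auto simp: C0_def comp_def intro!: continuous_intros)
    then have "compact (?d ` {0..1})" by (intro compact_continuous_image) auto
    then have bdd: "bdd_above (?d ` {0..1})" by (simp add: bounded_imp_bdd_above compact_imp_bounded)
    have "\<bar>(fst \<circ> p) u - (fst \<circ> q) u\<bar> \<le> (SUP s\<in>{0..1}. ?d s)" if "u \<in> {0..1}" for u
      using cSUP_upper[OF that bdd] by simp
    from dGH_le_of_tree_codings[OF f g h k this]
    show "dGH X Y / 2 \<le> (case w of (p, q) \<Rightarrow>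
        max (SUP s\<in>{0..1}. \<bar>fst (p s) - fst (q s)\<bar>) (SUP s\<in>{0..1}. \<bar>snd (p s) - snd (q s)\<bar>))"
      by (simp add: w)
  qed
  then show ?thesis by simp
qed

end
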